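(* For every positive integer $n$, $\chi'_{\{2K_2, C_4\}}(n)= \lceil n/2 \rceil$.
   Context: For a graph $G$ and a set $\mathcal H$ of small graphs, an $\mathcal H$-avoiding bipartite partition of $G$ is a collection of bipartite graphs $G_1,\dots,G_k$ (subgraphs of $G$, each without isolated vertices and nonempty) whose edge sets are pairwise disjoint with union $E(G)$, such that no $G_i$ contains any member of $\mathcal H$ as an induced subgraph. $\chi'_{\mathcal H}(G)$ is the smallest $k$ for which such a partition with $k$ graphs exists, and $\chi'_{\mathcal H}(n):=\chi'_{\mathcal H}(K_n)$, where $K_n$ is the complete graph on $n$ vertices. $2K_2$ is the disjoint union of two edges and $C_4$ is the cycle on 4 vertices.
   Formalization: Stated for n ≥ 2 instead of every positive integer n: for n = 1 the graph K_1 has no edges and every part must be nonempty without isolated vertices, so only the empty partition exists and the value is 0, not ⌈1/2⌉ = 1. *)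

theory Defs
  imports Complex_Main "HOL-Library.Disjoint_Sets"
begin

type_synonym 'a ugraph = "'a set \<times> 'a set set"

abbreviation verts :: "'a ugraph \<Rightarrow> 'a set" where "verts G \<equiv> fst G"
abbreviation edges :: "'a ugraph \<Rightarrow> 'a set set" where "edges G \<equiv> snd G"

definition simple_graph :: "'a ugraph \<Rightarrow> bool" where
  "simple_graph G \<longleftrightarrow> finite (verts G) \<and> (\<forall>e\<in>edges G. e \<subseteq> verts G \<and> card e = 2)"

definition subgraph :: "'a ugraph \<Rightarrow> 'a ugraph \<Rightarrow> bool" where
  "subgraph H G \<longleftrightarrow> simple_graph H \<and> verts H \<subseteq> verts G \<and> edges H \<subseteq> edges G"

definition induced_subgraph :: "'a ugraph \<Rightarrow> 'a set \<Rightarrow> 'a ugraph" where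
  "induced_subgraph G S = (S, {e \<in> edges G. e \<subseteq> S})"

definition graph_iso :: "'a ugraph \<Rightarrow> 'b ugraph \<Rightarrow> bool" where
  "graph_iso G H \<longleftrightarrow> (\<exists>f. bij_betw f (verts G) (verts H) \<and>
     (\<forall>u\<in>verts G. \<forall>v\<in>verts G. {u, v} \<in> edges G \<longleftrightarrow> {f u, f v} \<in> edges H))"

definition contains_induced :: "'a ugraph \<Rightarrow> 'b ugraph \<Rightarrow> bool" where
  "contains_induced G H \<longleftrightarrow> (\<exists>S\<subseteq>verts G. graph_iso (induced_subgraph G S) H)"

definition bipartite :: "'a ugraph \<Rightarrow> bool" where
  "bipartite G \<longleftrightarrow> (\<exists>A B. A \<inter> B = {} \<and> A \<union> B = verts G \<and>
     (\<forall>e\<in>edges G. \<exists>a\<in>A. \<exists>b\<in>B. e = {a, b}))"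

definition no_isolated :: "'a ugraph \<Rightarrow> bool" where
  "no_isolated G \<longleftrightarrow> (\<forall>v\<in>verts G. \<exists>e\<in>edges G. v \<in> e)"

definition avoiding_bipartite_partition ::
  "'b ugraph set \<Rightarrow> 'a ugraph \<Rightarrow> nat \<Rightarrow> (nat \<Rightarrow> 'a ugraph) \<Rightarrow> bool" where
  "avoiding_bipartite_partition \<H> G k Gs \<longleftrightarrow>
     (\<forall>i\<in>{1..k}. subgraph (Gs i) G \<and> bipartite (Gs i) \<and> no_isolated (Gs i) \<and> verts (Gs i) \<noteq> {}) \<and>
     disjoint_family_on (\<lambda>i. edges (Gs i)) {1..k} \<and>
     (\<Union>i\<in>{1..k}. edges (Gs i)) = edges G \<and>
     (\<forall>i\<in>{1..k}. \<forall>H\<in>\<H>. \<not> contains_induced (Gs i) H)"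

definition chi' :: "'b ugraph set \<Rightarrow> 'a ugraph \<Rightarrow> nat" where
  "chi' \<H> G = (LEAST k. \<exists>Gs. avoiding_bipartite_partition \<H> G k Gs)"

definition complete_graph :: "nat \<Rightarrow> nat ugraph" where
  "complete_graph n = ({1..n}, {e. e \<subseteq> {1..n} \<and> card e = 2})"

definition chi'_complete :: "'b ugraph set \<Rightarrow> nat \<Rightarrow> nat" where
  "chi'_complete \<H> n = chi' \<H> (complete_graph n)"

definition two_K2 :: "nat ugraph" where
  "two_K2 = ({1, 2, 3, 4}, {{1, 2}, {3, 4}})"

definition C4 :: "nat ugraph" where
  "C4 = ({1, 2, 3, 4}, {{1, 2}, {2, 3}, {3, 4}, {4, 1}})"

text \<open>Since the parts are required to be nonempty, the edgeless graph on one vertex has only the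
  empty partition, so \<open>\<lceil>n/2\<rceil>\<close> is not the correct value at \<open>n = 1\<close>.\<close>

lemma chi'_complete_1: "chi'_complete \<H> 1 = 0"
proof -
  have "edges (complete_graph 1) = {}"
    unfolding complete_graph_def by (auto simp: subset_singleton_iff)
  then have "avoiding_bipartite_partition \<H> (complete_graph 1) 0 (\<lambda>_. ({}, {}))"
    by (simp add: avoiding_bipartite_partition_def disjoint_family_on_def)
  then show ?thesis
    unfolding chi'_complete_def chi'_def by (intro Least_eq_0) blast
qed

end

theory Submission
  imports Defs
begin

text \<open>
  Fix a bipartition \<open>A\<close>, \<open>B\<close> of a graph without induced \<open>2K\<^sub>2\<close> and \<open>C\<^sub>4\<close>. Avoiding \<open>2K\<^sub>2\<close> makes the
  neighbourhoods of the vertices of \<open>A\<close> a chain, and avoiding \<open>C\<^sub>4\<close> makes any two of them share at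
  most one vertex. Hence all neighbourhoods but a largest one have at most one element, and the
  graph has at most \<open>|A| + |B| - 1\<close> edges. Counting the edges of \<open>K\<^sub>n\<close> gives the lower bound.

  For the upper bound, group the vertices into pairs \<open>(x\<^sub>i, y\<^sub>i)\<close> and let the \<open>i\<close>-th part be the double
  star with centres \<open>x\<^sub>i\<close>, \<open>y\<^sub>i\<close>, where for \<open>i < j\<close> the edges \<open>x\<^sub>i x\<^sub>j\<close>, \<open>y\<^sub>i y\<^sub>j\<close> go to part \<open>i\<close> and
  \<open>x\<^sub>i y\<^sub>j\<close>, \<open>y\<^sub>i x\<^sub>j\<close> go to part \<open>j\<close>. If \<open>n\<close> is odd, the last \<open>y\<close> is missing.
\<close>

section \<open>Induced copies as embeddings\<close>

text \<open>Inverting the isomorphism turns the vertex set \<open>S\<close> into a map out of the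
  pattern, so that a copy can be given by naming four vertices.\<close>

lemma contains_induced_iff_embedding:
  "contains_induced G H \<longleftrightarrow> (\<exists>g. inj_on g (verts H) \<and> g ` verts H \<subseteq> verts G \<and>
     (\<forall>u\<in>verts H. \<forall>v\<in>verts H. {g u, g v} \<in> edges G \<longleftrightarrow> {u, v} \<in> edges H))"
proof
  assume "contains_induced G H"
  then obtain S f where S: "S \<subseteq> verts G" and f: "bij_betw f S (verts H)"
    and e: "\<And>u v. u \<in> S \<Longrightarrow> v \<in> S \<Longrightarrow> {u, v} \<in> edges G \<longleftrightarrow> {f u, f v} \<in> edges H"
    unfolding contains_induced_def graph_iso_def induced_subgraph_def by auto
  let ?g = "inv_into S f"
  have g: "bij_betw ?g (verts H) S" using f by (rule bij_betw_inv_into)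
  have gS: "?g u \<in> S" if "u \<in> verts H" for u using g that by (auto dest: bij_betwE)
  have fg: "f (?g u) = u" if "u \<in> verts H" for u using f that by (rule bij_betw_inv_into_right)
  show "\<exists>g. inj_on g (verts H) \<and> g ` verts H \<subseteq> verts G \<and>
     (\<forall>u\<in>verts H. \<forall>v\<in>verts H. {g u, g v} \<in> edges G \<longleftrightarrow> {u, v} \<in> edges H)"
    using g S e gS fg by (intro exI[of _ ?g]) (auto simp: bij_betw_def)
next
  assume "\<exists>g. inj_on g (verts H) \<and> g ` verts H \<subseteq> verts G \<and>
     (\<forall>u\<in>verts H. \<forall>v\<in>verts H. {g u, g v} \<in> edges G \<longleftrightarrow> {u, v} \<in> edges H)"
  then obtain g where inj: "inj_on g (verts H)" and sub: "g ` verts H \<subseteq> verts G"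
    and e: "\<And>u v. u \<in> verts H \<Longrightarrow> v \<in> verts H \<Longrightarrow> {g u, g v} \<in> edges G \<longleftrightarrow> {u, v} \<in> edges H"
    by auto
  let ?S = "g ` verts H" and ?f = "inv_into (verts H) g"
  have "bij_betw ?f ?S (verts H)"
    using inj by (intro bij_betw_inv_into) (simp add: bij_betw_def)
  moreover have "{u, v} \<in> edges G \<longleftrightarrow> {?f u, ?f v} \<in> edges H" if "u \<in> ?S" "v \<in> ?S" for u v
    using that e inj by auto
  ultimately have "graph_iso (induced_subgraph G ?S) H"
    unfolding graph_iso_def induced_subgraph_def by (intro exI[of _ ?f]) auto
  then show "contains_induced G H"
    using sub unfolding contains_induced_def by blast
qed

lemma contains_induced_two_K2D:
  assumes "contains_induced G two_K2"
  obtains a b c d where "distinct [a, b, c, d]" "{a, b} \<in> edges G" "{c, d} \<in> edges G"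
    "{a, c} \<notin> edges G" "{a, d} \<notin> edges G" "{b, c} \<notin> edges G" "{b, d} \<notin> edges G"
proof -
  obtain g where g: "inj_on g {1, 2, 3, 4}" and "g ` {1, 2, 3, 4} \<subseteq> verts G"
    and e: "\<forall>u\<in>{1, 2, 3, 4}. \<forall>v\<in>{1, 2, 3, 4}.
      {g u, g v} \<in> edges G \<longleftrightarrow> {u, v} \<in> {{1, 2}, {3, 4::nat}}"
    using assms unfolding contains_induced_iff_embedding two_K2_def fst_conv snd_conv by (elim exE conjE)
  show ?thesis
    using g e[rule_format, of 1 2] e[rule_format, of 3 4]
      e[rule_format, of 1 3] e[rule_format, of 1 4]
      e[rule_format, of 2 3] e[rule_format, of 2 4]
    by (intro that[of "g 1" "g 2" "g 3" "g 4"]) (simp_all add: doubleton_eq_iff)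
qed

text \<open>Just the four edges are extracted, because a double star has no 4-cycle at all, induced
  or not.\<close>

lemma contains_induced_C4D:
  assumes "contains_induced G C4"
  obtains a b c d where "distinct [a, b, c, d]" "{a, b} \<in> edges G" "{b, c} \<in> edges G"
    "{c, d} \<in> edges G" "{d, a} \<in> edges G"
proof -
  obtain g where g: "inj_on g {1, 2, 3, 4}" and "g ` {1, 2, 3, 4} \<subseteq> verts G"
    and e: "\<forall>u\<in>{1, 2, 3, 4}. \<forall>v\<in>{1, 2, 3, 4}.
      {g u, g v} \<in> edges G \<longleftrightarrow> {u, v} \<in> {{1, 2}, {2, 3}, {3, 4}, {4, 1::nat}}"
    using assms unfolding contains_induced_iff_embedding C4_def fst_conv snd_conv by (elim exE conjE)
  show ?thesis
    using g e[rule_format, of 1 2] e[rule_format, of 2 3] e[rule_format, of 3 4]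
      e[rule_format, of 4 1]
    by (intro that[of "g 1" "g 2" "g 3" "g 4"]) (simp_all add: doubleton_eq_iff)
qed

lemma simple_graph_no_loop: "simple_graph G \<Longrightarrow> {u} \<notin> edges G"
  unfolding simple_graph_def by fastforce

lemma contains_induced_two_K2I:
  assumes "simple_graph G" and "distinct [a, b, c, d]" and "{a, b} \<in> edges G" "{c, d} \<in> edges G"
    and "{a, c} \<notin> edges G" "{a, d} \<notin> edges G" "{b, c} \<notin> edges G" "{b, d} \<notin> edges G"
  shows "contains_induced G two_K2"
proof -
  let ?g = "\<lambda>i::nat. if i = 1 then a else if i = 2 then b else if i = 3 then c else d"
  have "{a, b, c, d} \<subseteq> verts G"
    using assms(1,3,4) unfolding simple_graph_def by blast
  \<comment> \<open>The embedding condition also covers \<open>u = v\<close>, where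
    \<open>{g u, g v}\<close> is a singleton; absence of loops settles these pairs.\<close>
  then show ?thesis
    using assms(2-) simple_graph_no_loop[OF assms(1)]
    unfolding contains_induced_iff_embedding two_K2_def fst_conv snd_conv
    by (intro exI[of _ ?g]) (simp add: doubleton_eq_iff, simp add: insert_commute)
qed

lemma contains_induced_C4I:
  assumes "simple_graph G" and "distinct [a, b, c, d]"
    and "{a, b} \<in> edges G" "{b, c} \<in> edges G" "{c, d} \<in> edges G" "{d, a} \<in> edges G"
    and "{a, c} \<notin> edges G" "{b, d} \<notin> edges G"
  shows "contains_induced G C4"
proof -
  let ?g = "\<lambda>i::nat. if i = 1 then a else if i = 2 then b else if i = 3 then c else d"
  have "{a, b, c, d} \<subseteq> verts G"
    using assms(1,3,5) unfolding simple_graph_def by blast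
  then show ?thesis
    using assms(2-) simple_graph_no_loop[OF assms(1)]
    unfolding contains_induced_iff_embedding C4_def fst_conv snd_conv
    by (intro exI[of _ ?g]) (simp add: doubleton_eq_iff, simp add: insert_commute)
qed

section \<open>Edge bound for one part and the lower bound\<close>

lemma card_edges_le_if_avoiding:
  assumes "simple_graph G" and "bipartite G"
    and no2K2: "\<not> contains_induced G two_K2" and noC4: "\<not> contains_induced G C4"
  shows "card (edges G) \<le> card (verts G) - 1"
proof -
  obtain A B where AB: "A \<inter> B = {}" "A \<union> B = verts G"
    and edge: "\<forall>e\<in>edges G. \<exists>a\<in>A. \<exists>b\<in>B. e = {a, b}"
    using assms(2) unfolding bipartite_def by (elim exE conjE)
  have "finite (verts G)" using assms(1) by (simp add: simple_graph_def)
  then have fin: "finite A" "finite B" using AB by (metis finite_Un)+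
  have AA: "{a, a'} \<notin> edges G" if "a \<in> A" "a' \<in> A" for a a'
    using bspec[OF edge, of "{a, a'}"] that AB(1) by (auto simp: doubleton_eq_iff)
  have BB: "{b, b'} \<notin> edges G" if "b \<in> B" "b' \<in> B" for b b'
    using bspec[OF edge, of "{b, b'}"] that AB(1) by (auto simp: doubleton_eq_iff)
  define N where "N a = {b \<in> B. {a, b} \<in> edges G}" for a
  have finN: "finite (N a)" for a using fin by (simp add: N_def)
  have chain: "N a \<subseteq> N a' \<or> N a' \<subseteq> N a" if a: "a \<in> A" "a' \<in> A" for a a'
  proof (rule ccontr)
    assume "\<not> ?thesis"
    then obtain b b' where b: "b \<in> N a" "b \<notin> N a'" "b' \<in> N a'" "b' \<notin> N a" by blast
    then have "distinct [a, b, a', b']" using a AB(1) by (auto simp: N_def)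
    \<comment> \<open>The edges \<open>{a, b}\<close> and \<open>{a', b'}\<close> induce a
      \<open>two_K2\<close>: the pairs across the classes are missing by choice of \<open>b\<close>
      and \<open>b'\<close>, the pairs within a class by bipartiteness.\<close>
    then show False
      using contains_induced_two_K2I[OF assms(1), of a b a' b'] no2K2 a b AA BB
      by (auto simp: N_def insert_commute)
  qed
  have share: "card (N a \<inter> N a') \<le> 1" if a: "a \<in> A" "a' \<in> A" "a \<noteq> a'" for a a'
  proof -
    have "b = b'" if b: "b \<in> N a \<inter> N a'" "b' \<in> N a \<inter> N a'" for b b'
    proof (rule ccontr)
      assume "b \<noteq> b'"
      then have "distinct [a, b, a', b']" using a b AB(1) by (auto simp: N_def)
      \<comment> \<open>Both diagonals of the cycle \<open>a b a' b'\<close> lie within a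
        class.\<close>
      then show False
        using contains_induced_C4I[OF assms(1), of a b a' b'] noC4 a b AA BB
        by (auto simp: N_def insert_commute)
    qed
    then show ?thesis using finN by (simp add: card_le_Suc0_iff_eq)
  qed
  have edges_eq: "edges G = (\<Union>a\<in>A. (\<lambda>b. {a, b}) ` N a)"
    using edge by (fastforce simp: N_def)
  show ?thesis
  proof (cases "A = {}")
    case True
    then show ?thesis using edges_eq by simp
  next
    case False
    then have "Max ((\<lambda>a. card (N a)) ` A) \<in> (\<lambda>a. card (N a)) ` A"
      using fin by (intro Max_in) auto
    then obtain a0 where a0: "a0 \<in> A" "card (N a0) = Max ((\<lambda>a. card (N a)) ` A)" by auto
    have small: "card (N a) \<le> 1" if a: "a \<in> A - {a0}" for a
    proof -
      \<comment> \<open>By maximality of \<open>a0\<close> the chain property gives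
        \<open>N a \<subseteq> N a0\<close>, the opposite inclusion forcing equality; so
        \<open>N a\<close> is the intersection bounded by \<open>share\<close>.\<close>
      have "card (N a) \<le> card (N a0)" using a a0 fin by simp
      then have "N a \<subseteq> N a0"
        using chain[of a a0] a a0(1) finN by (metis DiffD1 card_seteq order_refl)
      then show ?thesis using share[of a a0] a a0(1) by (simp add: Int_absorb2)
    qed
    have "card (edges G) \<le> (\<Sum>a\<in>A. card ((\<lambda>b. {a, b}) ` N a))"
      unfolding edges_eq using fin by (intro card_UN_le)
    also have "\<dots> \<le> (\<Sum>a\<in>A. card (N a))"
      using finN by (intro sum_mono card_image_le)
    also have "\<dots> = card (N a0) + (\<Sum>a\<in>A - {a0}. card (N a))"
      using a0 fin by (intro sum.remove)
    also have "\<dots> \<le> card B + card (A - {a0})"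
      using sum_mono[of "A - {a0}" "\<lambda>a. card (N a)" "\<lambda>_. 1"] small
        card_mono[OF fin(2), of "N a0"] by (auto simp: N_def)
    also have "\<dots> = card (verts G) - 1"
    proof -
      have "card (verts G) = card A + card B" using AB fin card_Un_disjoint by metis
      moreover have "card A > 0" using a0(1) fin by (auto simp: card_gt_0_iff)
      ultimately show ?thesis using a0(1) fin by (simp add: card_Diff_singleton)
    qed
    finally show ?thesis .
  qed
qed

lemma avoiding_partition_complete_ge:
  assumes "n \<ge> 2" and "avoiding_bipartite_partition {two_K2, C4} (complete_graph n) k Gs"
  shows "n \<le> 2 * k"
proof -
  have part: "card (edges (Gs i)) \<le> n - 1" if "i \<in> {1..k}" for i
  proof -
    have sub: "subgraph (Gs i) (complete_graph n)" and "bipartite (Gs i)"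
      "\<not> contains_induced (Gs i) two_K2" "\<not> contains_induced (Gs i) C4"
      using assms(2) that unfolding avoiding_bipartite_partition_def by auto
    then have "card (edges (Gs i)) \<le> card (verts (Gs i)) - 1"
      by (intro card_edges_le_if_avoiding) (simp_all add: subgraph_def)
    moreover have "card (verts (Gs i)) \<le> n"
      using sub card_mono[of "{1..n}" "verts (Gs i)"]
      by (simp add: subgraph_def complete_graph_def)
    ultimately show ?thesis by simp
  qed
  have "n choose 2 = card (edges (complete_graph n))"
    by (simp add: complete_graph_def n_subsets)
  also have "\<dots> = card (\<Union>i\<in>{1..k}. edges (Gs i))"
    using assms(2) unfolding avoiding_bipartite_partition_def by simp
  also have "\<dots> \<le> (\<Sum>i\<in>{1..k}. card (edges (Gs i)))"
    by (intro card_UN_le) simp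
  also have "\<dots> \<le> k * (n - 1)"
    using sum_bounded_above[of "{1..k}" "\<lambda>i. card (edges (Gs i))" "n - 1"] part by simp
  finally have "n * (n - 1) div 2 \<le> k * (n - 1)" by (simp add: choose_two)
  moreover have "even (n * (n - 1))" by auto
  then have "2 * (n * (n - 1) div 2) = n * (n - 1)" by (rule dvd_mult_div_cancel)
  ultimately have "n * (n - 1) \<le> 2 * k * (n - 1)" by linarith
  \<comment> \<open>Cancelling \<open>n - 1\<close> requires it to be positive; for
    \<open>n = 1\<close> the empty partition violates the bound.\<close>
  then show ?thesis using assms(1) by simp
qed

section \<open>Double stars\<close>

text \<open>Stars are included: \<open>y\<close> need not be covered by \<open>E\<close>.\<close>

definition double_star_edges :: "'a set set \<Rightarrow> 'a \<Rightarrow> 'a \<Rightarrow> bool" where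
  "double_star_edges E x y \<longleftrightarrow> x \<noteq> y \<and> (\<forall>e\<in>E. card e = 2 \<and> (x \<in> e \<or> y \<in> e)) \<and>
     (\<forall>e\<in>E. y \<in> e \<longrightarrow> {x, y} \<in> E) \<and> (\<forall>z. \<not> ({x, z} \<in> E \<and> {y, z} \<in> E))"

text \<open>One class holds \<open>x\<close> and the neighbours of \<open>y\<close>, the other
  \<open>y\<close> and the neighbours of \<open>x\<close>. They do not clash because the centres
  have no common neighbour.\<close>

lemma double_star_bipartite:
  assumes "double_star_edges E x y"
  shows "bipartite (\<Union>E, E)"
proof -
  let ?A = "{v \<in> \<Union>E. v = x \<or> v \<noteq> y \<and> {y, v} \<in> E}"
  have split: "\<exists>a\<in>?A. \<exists>b\<in>\<Union>E - ?A. e = {a, b}" if e: "e \<in> E" for e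
  proof -
    obtain u v where uv: "e = {u, v}" "u \<noteq> v" "u = x \<or> u = y"
    proof -
      from assms e have "card e = 2" "x \<in> e \<or> y \<in> e" by (auto simp: double_star_edges_def)
      then show ?thesis using that by (auto simp: card_2_iff insert_commute)
    qed
    show ?thesis
    proof (cases "u = x")
      case True
      then have "u \<in> ?A" "v \<in> \<Union>E - ?A"
        using e uv assms by (auto simp: double_star_edges_def)
      then show ?thesis using uv(1) by (intro bexI[of _ u] bexI[of _ v])
    next
      case False
      then have "v \<in> ?A" "u \<in> \<Union>E - ?A"
        using e uv assms by (auto simp: double_star_edges_def)
      moreover have "e = {v, u}" using uv(1) by (simp add: insert_commute)
      ultimately show ?thesis by (intro bexI[of _ v] bexI[of _ u])
    qed
  qed
  have "?A \<inter> (\<Union>E - ?A) = {}" "?A \<union> (\<Union>E - ?A) = \<Union>E" by blast+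
  then show ?thesis unfolding bipartite_def fst_conv snd_conv
    by (intro exI[of _ ?A] exI[of _ "\<Union>E - ?A"] conjI ballI split)
qed

text \<open>Each of two disjoint edges contains a centre, so one contains \<open>x\<close> and the
  other \<open>y\<close>. Then \<open>{x, y}\<close> is an edge joining them.\<close>

lemma double_star_avoids_two_K2:
  assumes "double_star_edges E x y"
  shows "\<not> contains_induced (V, E) two_K2"
proof
  assume *: "contains_induced (V, E) two_K2"
  obtain a b c d where abcd: "distinct [a, b, c, d]" "{a, b} \<in> E" "{c, d} \<in> E"
    "{a, c} \<notin> E" "{a, d} \<notin> E" "{b, c} \<notin> E" "{b, d} \<notin> E"
    by (rule contains_induced_two_K2D[OF *, unfolded snd_conv])
  have cover: "x \<in> e \<or> y \<in> e" and adj: "y \<in> e \<Longrightarrow> {x, y} \<in> E" if "e \<in> E" for e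
    using assms that by (auto simp: double_star_edges_def)
  have disj: "{a, b} \<inter> {c, d} = {}" using abcd(1) by simp
  have "y \<in> {a, b} \<or> y \<in> {c, d}"
    using cover[OF abcd(2)] cover[OF abcd(3)] disj by blast
  then have "{x, y} \<in> E"
    using adj[OF abcd(2)] adj[OF abcd(3)] by blast
  moreover have "{x, y} = {a, c} \<or> {x, y} = {a, d} \<or> {x, y} = {b, c} \<or> {x, y} = {b, d}"
    using cover[OF abcd(2)] cover[OF abcd(3)] abcd(1)
    unfolding doubleton_eq_iff by simp metis
  ultimately show False using abcd(4-7) by metis
qed

text \<open>Two vertices that meet all edges of a 4-cycle are opposite on it, so the centres would
  have a common neighbour.\<close>

lemma double_star_avoids_C4:
  assumes "double_star_edges E x y"
  shows "\<not> contains_induced (V, E) C4"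
proof
  assume *: "contains_induced (V, E) C4"
  obtain a b c d where abcd: "distinct [a, b, c, d]" "{a, b} \<in> E" "{b, c} \<in> E"
    "{c, d} \<in> E" "{d, a} \<in> E"
    by (rule contains_induced_C4D[OF *, unfolded snd_conv])
  have cover: "x \<in> e \<or> y \<in> e" if "e \<in> E" for e
    using assms that unfolding double_star_edges_def by blast
  have no_common: "\<not> ({x, z} \<in> E \<and> {y, z} \<in> E)" for z
    using assms unfolding double_star_edges_def by blast
  have "{x, y} = {a, c} \<or> {x, y} = {b, d}"
    using cover[OF abcd(2)] cover[OF abcd(3)] cover[OF abcd(4)] cover[OF abcd(5)] abcd(1)
    unfolding doubleton_eq_iff by simp metis
  then show False
  proof
    assume "{x, y} = {a, c}"
    then show False
      using no_common[of b] abcd(2,3) by (auto simp: doubleton_eq_iff insert_commute)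
  next
    assume "{x, y} = {b, d}"
    then show False
      using no_common[of a] abcd(2,5) by (auto simp: doubleton_eq_iff insert_commute)
  qed
qed

section \<open>The partition of the complete graph\<close>

text \<open>The part that receives the edge \<open>{u, v}\<close>, \<open>u < v\<close>: the \<open>i\<close>-th pair is
  \<open>x\<^sub>i = 2i - 1\<close>, \<open>y\<^sub>i = 2i\<close>.\<close>

definition part_of :: "nat \<Rightarrow> nat \<Rightarrow> nat" where
  "part_of u v = (if even u \<longleftrightarrow> even v then (u + 1) div 2 else (v + 1) div 2)"

definition part_edges :: "nat \<Rightarrow> nat \<Rightarrow> nat set set" where
  "part_edges n i = {{u, v} | u v. 1 \<le> u \<and> u < v \<and> v \<le> n \<and> part_of u v = i}"

lemma doubleton_in_part_edges_iff:
  "{u, v} \<in> part_edges n i \<longleftrightarrow> u \<noteq> v \<and> 1 \<le> min u v \<and> max u v \<le> n \<and> part_of (min u v) (max u v) = i"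
  unfolding part_edges_def
  by (cases u v rule: linorder_cases) (auto simp: doubleton_eq_iff min_def max_def)

lemma double_star_part_edges:
  assumes "i \<ge> 1"
  shows "double_star_edges (part_edges n i) (2 * i - 1) (2 * i)"
  unfolding double_star_edges_def
proof (intro conjI ballI allI impI)
  show "2 * i - 1 \<noteq> 2 * i" using assms by simp
next
  fix e assume "e \<in> part_edges n i"
  then obtain u v where uv: "e = {u, v}" "1 \<le> u" "u < v" "v \<le> n" "part_of u v = i"
    unfolding part_edges_def by blast
  then show "card e = 2" by simp
  have "u = 2 * i - 1 \<or> u = 2 * i \<or> v = 2 * i - 1 \<or> v = 2 * i"
    using uv(5) unfolding part_of_def by (auto split: if_splits; presburger)
  then show "2 * i - 1 \<in> e \<or> 2 * i \<in> e" using uv(1) by auto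
next
  fix e assume "e \<in> part_edges n i" "2 * i \<in> e"
  \<comment> \<open>For odd \<open>n\<close> and the last \<open>i\<close>, \<open>2 * i\<close> is
    \<open>n + 1\<close>, not a vertex, and the part is a star around \<open>n\<close>; an edge
    through \<open>2 * i\<close> rules this out.\<close>
  then have "2 * i \<le> n" unfolding part_edges_def by auto
  then show "{2 * i - 1, 2 * i} \<in> part_edges n i"
    using assms by (auto simp: doubleton_in_part_edges_iff part_of_def)
next
  fix z
  \<comment> \<open>The centres have opposite parity, so whether \<open>z\<close> comes before or
    after the pair, at most one of the two edges is assigned to part \<open>i\<close>.\<close>
  show "\<not> ({2 * i - 1, z} \<in> part_edges n i \<and> {2 * i, z} \<in> part_edges n i)"
    using assms unfolding doubleton_in_part_edges_iff part_of_def min_def max_def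
    by (auto split: if_splits; presburger)
qed

lemma part_edges_nonempty:
  assumes "n \<ge> 2" "i \<ge> 1" "i \<le> (n + 1) div 2"
  shows "part_edges n i \<noteq> {}"
proof (cases "2 * i \<le> n")
  case True
  then have "{2 * i - 1, 2 * i} \<in> part_edges n i"
    using assms by (auto simp: doubleton_in_part_edges_iff part_of_def)
  then show ?thesis by blast
next
  case False
  then have "n = 2 * i - 1" "i \<ge> 2" using assms by presburger+
  \<comment> \<open>The vertex \<open>n\<close> has no partner here. As \<open>n\<close> is odd and
    2 is even, the edge goes to the pair of its larger end.\<close>
  then have "{2, n} \<in> part_edges n i"
    by (auto simp: doubleton_in_part_edges_iff part_of_def)
  then show ?thesis by blast
qed

lemma UN_part_edges: "(\<Union>i\<in>{1..(n + 1) div 2}. part_edges n i) = edges (complete_graph n)"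
proof (intro equalityI subsetI)
  fix e assume "e \<in> (\<Union>i\<in>{1..(n + 1) div 2}. part_edges n i)"
  then show "e \<in> edges (complete_graph n)"
    unfolding part_edges_def complete_graph_def by auto
next
  fix e assume "e \<in> edges (complete_graph n)"
  then obtain x y where xy: "e = {x, y}" "x \<noteq> y" "x \<in> {1..n}" "y \<in> {1..n}"
    unfolding complete_graph_def card_2_iff by auto
  define u v where "u = min x y" and "v = max x y"
  then have uv: "e = {u, v}" "u < v" "1 \<le> u" "v \<le> n"
    using xy by (auto simp: min_def max_def)
  then have "part_of u v \<in> {1..(n + 1) div 2}"
    using div_le_mono[of "v + 1" "n + 1" 2] div_le_mono[of "u + 1" "n + 1" 2]
      div_le_mono[of 2 "u + 1" 2] div_le_mono[of 2 "v + 1" 2]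
    by (simp add: part_of_def)
  then show "e \<in> (\<Union>i\<in>{1..(n + 1) div 2}. part_edges n i)"
    using uv unfolding part_edges_def by blast
qed

lemma disjoint_part_edges: "disjoint_family_on (part_edges n) I"
proof -
  have "i = j" if e: "e \<in> part_edges n i" "e \<in> part_edges n j" for e i j
  proof -
    obtain u v where "e = {u, v}" using e(1) unfolding part_edges_def by blast
    then show ?thesis using e doubleton_in_part_edges_iff by metis
  qed
  then show ?thesis unfolding disjoint_family_on_def by blast
qed

lemma avoiding_partition_complete_exists:
  assumes "n \<ge> 2"
  shows "avoiding_bipartite_partition {two_K2, C4} (complete_graph n) ((n + 1) div 2)
    (\<lambda>i. (\<Union>(part_edges n i), part_edges n i))"
  unfolding avoiding_bipartite_partition_def
proof (intro conjI ballI)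
  fix i assume i: "i \<in> {1..(n + 1) div 2}"
  \<comment> \<open>Taking only the covered vertices leaves none isolated.\<close>
  let ?G = "(\<Union>(part_edges n i), part_edges n i)"
  have ds: "double_star_edges (part_edges n i) (2 * i - 1) (2 * i)"
    using i by (intro double_star_part_edges) simp
  have sub: "part_edges n i \<subseteq> edges (complete_graph n)"
    using UN_part_edges[of n] i by blast
  then have V: "\<Union>(part_edges n i) \<subseteq> {1..n}" by (auto simp: complete_graph_def)
  then have "finite (\<Union>(part_edges n i))" by (rule finite_subset) simp
  then show "subgraph ?G (complete_graph n)"
    using sub V by (auto simp: subgraph_def simple_graph_def complete_graph_def)
  show "bipartite ?G" using ds by (rule double_star_bipartite)
  show "no_isolated ?G" by (auto simp: no_isolated_def)
  obtain e where "e \<in> part_edges n i" using part_edges_nonempty[of n i] assms i by auto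
  then show "verts ?G \<noteq> {}" by (auto simp: part_edges_def)
  fix H assume "H \<in> {two_K2, C4}"
  then show "\<not> contains_induced ?G H"
    using double_star_avoids_two_K2[OF ds] double_star_avoids_C4[OF ds] by blast
qed (use UN_part_edges disjoint_part_edges in simp_all)

text \<open>The case \<open>n = 1\<close> is left out since \<open>chi'_complete_1\<close> gives 0
  there and the ceiling is 1.\<close>

theorem mainTheorem3:
  fixes n :: nat
  assumes "n \<ge> 2"
  shows "int (chi'_complete {two_K2, C4} n) = \<lceil>real n / 2\<rceil>"
proof -
  have "chi'_complete {two_K2, C4} n = (n + 1) div 2"
    unfolding chi'_complete_def chi'_def
  proof (rule Least_equality)
    show "\<exists>Gs. avoiding_bipartite_partition {two_K2, C4} (complete_graph n) ((n + 1) div 2) Gs"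
      using avoiding_partition_complete_exists[OF assms] by blast
  next
    fix k assume "\<exists>Gs. avoiding_bipartite_partition {two_K2, C4} (complete_graph n) k Gs"
    then show "(n + 1) div 2 \<le> k"
      using avoiding_partition_complete_ge[OF assms] by fastforce
  qed
  moreover have "\<lceil>real n / 2\<rceil> = int ((n + 1) div 2)"
    by (rule ceiling_unique) (auto simp: field_simps; linarith)+
  ultimately show ?thesis by simp
qed

end
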